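(* Let $d,\lambda,k,a_1,\dots,a_d$ be positive integers, let $n=\prod_{i=1}^d a_i$ and let $b_i=n/a_i$ for $i\in[d]$, and fix a partition of $[n]^d$ into $(b_1,\dots,b_d)$-blocks. If $r_1,\dots,r_k$ are positive integers satisfying $$\sum_{j=1}^k r_j=\lambda n^{d-1},$$ then there exists a $\lambda$-fold hypercube of order $n$ and dimension $d$ on the $k$ symbols $1,\dots,k$ such that, for every $j\in[k]$, every hyperplane and every $(b_1,\dots,b_d)$-block contains exactly $r_j$ occurrences of symbol $j$, and the multiplicity of symbol $j$ in every cell is either $$\left\lfloor\frac{r_j}{n^{d-1}}\right\rfloor\qquad\text{or}\qquad\left\lceil\frac{r_j}{n^{d-1}}\right\rceil.$$ Moreover, the $\lambda$-fold hypercube can be chosen simple if and only if $r_j\le n^{d-1}$ for every $j\in[k]$.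
   Context: Write $[n]=\{1,\dots,n\}$. A $\lambda$-fold hypercube of order $n$ and dimension $d$ on a symbol set $S$ assigns to each cell of $[n]^d$ a multiset of exactly $\lambda$ symbols from $S$; occurrences of a symbol in a set of cells are counted with multiplicity. It is simple if no symbol is repeated within a cell. A hyperplane is the set of $n^{d-1}$ cells obtained by fixing one of the $d$ coordinates to a given value and letting the others vary. Block partition: for each $i\in[d]$, the $i$th coordinate set $[n]$ is partitioned into $a_i$ groups, each of size $b_i$. A $(b_1,\dots,b_d)$-block is a Cartesian product of $d$ groups, one chosen from each coordinate's partition. There are $n$ blocks, each with $n^{d-1}$ cells. *)

theory Defs
  imports Complex_Main "HOL-Library.Multiset" "HOL-Library.FuncSet" "HOL-Library.Disjoint_Sets"
begin

text \<open>
  A cell of \<open>[n]\<^sup>d\<close> is an extensional function on the coordinate set \<open>{1..d}\<close>.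
\<close>

definition cells :: "nat \<Rightarrow> nat \<Rightarrow> (nat \<Rightarrow> nat) set" where
  "cells n d = (\<Pi>\<^sub>E i\<in>{1..d}. {1..n})"

text \<open>
  A hypercube is a total function; its values outside \<open>cells n d\<close> are irrelevant.
\<close>

definition fold_hypercube ::
    "nat \<Rightarrow> nat \<Rightarrow> nat \<Rightarrow> 's set \<Rightarrow> ((nat \<Rightarrow> nat) \<Rightarrow> 's multiset) \<Rightarrow> bool" where
  "fold_hypercube l n d S L \<longleftrightarrow> (\<forall>c\<in>cells n d. size (L c) = l \<and> set_mset (L c) \<subseteq> S)"

definition simple_hypercube :: "nat \<Rightarrow> nat \<Rightarrow> ((nat \<Rightarrow> nat) \<Rightarrow> 's multiset) \<Rightarrow> bool" where
  "simple_hypercube n d L \<longleftrightarrow> (\<forall>c\<in>cells n d. \<forall>s. count (L c) s \<le> 1)"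

definition occurrences ::
    "((nat \<Rightarrow> nat) \<Rightarrow> 's multiset) \<Rightarrow> 's \<Rightarrow> (nat \<Rightarrow> nat) set \<Rightarrow> nat" where
  "occurrences L s C = (\<Sum>c\<in>C. count (L c) s)"

definition hyperplanes :: "nat \<Rightarrow> nat \<Rightarrow> (nat \<Rightarrow> nat) set set" where
  "hyperplanes n d = {{c \<in> cells n d. c i = v} | i v. i \<in> {1..d} \<and> v \<in> {1..n}}"

text \<open>
  \<open>P i\<close> is the set of groups into which the \<open>i\<close>th coordinate set is partitioned.
\<close>

definition coordinate_partitions ::
    "nat \<Rightarrow> nat \<Rightarrow> (nat \<Rightarrow> nat) \<Rightarrow> (nat \<Rightarrow> nat) \<Rightarrow> (nat \<Rightarrow> nat set set) \<Rightarrow> bool" where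
  "coordinate_partitions n d a b P \<longleftrightarrow>
     (\<forall>i\<in>{1..d}. partition_on {1..n} (P i) \<and> card (P i) = a i \<and> (\<forall>G\<in>P i. card G = b i))"

definition blocks :: "nat \<Rightarrow> (nat \<Rightarrow> nat set set) \<Rightarrow> (nat \<Rightarrow> nat) set set" where
  "blocks d P = {(\<Pi>\<^sub>E i\<in>{1..d}. G i) | G. \<forall>i\<in>{1..d}. G i \<in> P i}"

definition balanced_hypercube ::
    "nat \<Rightarrow> nat \<Rightarrow> nat \<Rightarrow> nat \<Rightarrow> (nat \<Rightarrow> nat) \<Rightarrow> (nat \<Rightarrow> nat set set) \<Rightarrow>
     ((nat \<Rightarrow> nat) \<Rightarrow> nat multiset) \<Rightarrow> bool" where
  "balanced_hypercube l n d k r P L \<longleftrightarrow>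
     fold_hypercube l n d {1..k} L \<and>
     (\<forall>j\<in>{1..k}.
        (\<forall>H\<in>hyperplanes n d. occurrences L j H = r j) \<and>
        (\<forall>B\<in>blocks d P. occurrences L j B = r j) \<and>
        (\<forall>c\<in>cells n d.
           int (count (L c) j) = \<lfloor>real (r j) / real (n ^ (d - 1))\<rfloor> \<or>
           int (count (L c) j) = \<lceil>real (r j) / real (n ^ (d - 1))\<rceil>))"

end

theory Submission
  imports Defs
begin

text \<open>
  The cells split into \<open>N = n^(d-1)\<close> classes, each of which meets every hyperplane and every block
  in exactly one cell. Once such classes exist, it suffices to give all cells of a class the same
  multiset of \<open>l\<close> symbols: a symbol then occurs in a hyperplane or block as often as it occurs in
  all the class multisets together.

  To find the classes, put \<open>A = \<Prod>\<^sub>m \<int>/a\<^sub>m\<close>, a group of order \<open>n\<close>. Since the groups of coordinate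
  \<open>i\<close> are \<open>a\<^sub>i\<close> in number and each has size \<open>n / a\<^sub>i\<close>, the coordinate set \<open>[n]\<close> can be identified
  with \<open>A\<close> in such a way that the group of a value is its \<open>i\<close>th component
  (\<open>coding_by_residues\<close>). A cell becomes a tuple \<open>(x\<^sub>1, \<dots>, x\<^sub>d)\<close> of elements of \<open>A\<close>; fixing a
  hyperplane means fixing one \<open>x\<^sub>i\<close>, and fixing a block means fixing the diagonal entries
  \<open>x\<^sub>1\<^sub>1, \<dots>, x\<^sub>d\<^sub>d\<close>. The classes are the cosets of the diagonal copy of \<open>A\<close> in \<open>A^d\<close>: moving inside a
  coset adds one \<open>s \<in> A\<close> to every \<open>x\<^sub>i\<close>, and \<open>s\<close> can be read off from any single \<open>x\<^sub>i\<close> as well as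
  from the diagonal entries (\<open>difference_class_inj\<close>).

  The class multisets come from dealing (\<open>dealing_symbols\<close>): write the \<open>r\<^sub>1 + \<dots> + r\<^sub>k = l N\<close>
  symbols in a row, all copies of a symbol next to each other, and deal them cyclically to the \<open>N\<close>
  classes. Each class receives \<open>l\<close> symbols, and a run of \<open>r\<^sub>j\<close> equal symbols is spread over the
  classes as evenly as possible.

  Simplicity then costs nothing: if \<open>r\<^sub>j \<le> N\<close>, both permitted multiplicities are at most 1. Conversely,
  in a simple hypercube a hyperplane has room for at most \<open>N\<close> copies of a symbol.
\<close>

section \<open>Dealing symbols evenly to classes\<close>

lemma arrange_in_runs:
  fixes r :: "nat \<Rightarrow> nat"
  shows "\<exists>f u. (\<forall>s<(\<Sum>j\<in>{1..k}. r j). f s \<in> {1..k}) \<and>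
    (\<forall>j\<in>{1..k}. {s. s < (\<Sum>j\<in>{1..k}. r j) \<and> f s = j} = {u j..<u j + r j})"
proof (induction k)
  case 0
  then show ?case by simp
next
  case (Suc k)
  define R where "R = (\<Sum>j\<in>{1..k}. r j)"
  obtain f u where f: "\<And>s. s < R \<Longrightarrow> f s \<in> {1..k}"
    and u: "\<And>j. j \<in> {1..k} \<Longrightarrow> {s. s < R \<and> f s = j} = {u j..<u j + r j}"
    using Suc unfolding R_def[symmetric] by metis
  define f' where "f' s = (if s < R then f s else Suc k)" for s
  define u' where "u' = u(Suc k := R)"
  have tot: "(\<Sum>j\<in>{1..Suc k}. r j) = R + r (Suc k)" by (simp add: R_def)
  have "{s. s < R + r (Suc k) \<and> f' s = j} = {u' j..<u' j + r j}" if "j \<in> {1..Suc k}" for j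
  proof (cases "j = Suc k")
    case True
    have "f' s = Suc k \<longleftrightarrow> R \<le> s" for s using f[of s] by (cases "s < R") (auto simp: f'_def)
    then show ?thesis using True by (simp add: u'_def set_eq_iff) blast
  next
    case False
    then have j: "j \<in> {1..k}" using that by auto
    have "s < R + r (Suc k) \<and> f' s = j \<longleftrightarrow> s < R \<and> f s = j" for s
      using False by (cases "s < R") (simp_all add: f'_def)
    then show ?thesis using u[OF j] False by (simp add: u'_def)
  qed
  moreover have "f' s \<in> {1..Suc k}" for s
    using f[of s] by (cases "s < R") (simp_all add: f'_def)
  ultimately show ?case unfolding tot by (intro exI[of _ f'] exI[of _ u']) simp
qed

lemma card_residue_full_period:
  fixes N t u :: nat
  assumes "t < N"
  shows "card {s \<in> {u..<u + N}. s mod N = t} = 1"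
proof (induction u)
  case 0
  have "{s \<in> {0..<0 + N}. s mod N = t} = {t}" using assms by auto
  then show ?case by simp
next
  case (Suc u)
  let ?I = "{s \<in> {Suc u..<u + N}. s mod N = t}"
  have fin: "finite ?I" by simp
  have "{s \<in> {u..<u + N}. s mod N = t} = (if u mod N = t then insert u ?I else ?I)"
    using assms by (auto simp: le_eq_less_or_eq)
  moreover have "{s \<in> {Suc u..<Suc u + N}. s mod N = t}
      = (if u mod N = t then insert (u + N) ?I else ?I)"
    using assms by (auto simp: less_Suc_eq)
  ultimately show ?case using Suc fin by (auto split: if_splits)
qed

lemma card_residue_run:
  fixes N t u r :: nat
  assumes t: "t < N"
  shows "card {s \<in> {u..<u + r}. s mod N = t} = r div N \<or>
    (card {s \<in> {u..<u + r}. s mod N = t} = r div N + 1 \<and> r mod N > 0)"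
proof (induction r rule: less_induct)
  case (less r)
  show ?case
  proof (cases "r < N")
    case True
    \<comment> \<open>Any \<open>N\<close> consecutive numbers contain the residue only once.\<close>
    have "card {s \<in> {u..<u + r}. s mod N = t} \<le> card {s \<in> {u..<u + N}. s mod N = t}"
      using True by (intro card_mono) auto
    then have le: "card {s \<in> {u..<u + r}. s mod N = t} \<le> 1"
      using card_residue_full_period[OF t, of u] by simp
    show ?thesis
    proof (cases "r = 0")
      case False
      then have "r div N = 0" "r mod N > 0" using True by auto
      then show ?thesis using le by linarith
    qed simp
  next
    case False
    define q where "q = r - N"
    have r: "r = q + N" and "q < r" using False t by (auto simp: q_def)
    have "{s \<in> {u..<u + r}. s mod N = t}
        = {s \<in> {u..<u + q}. s mod N = t} \<union> {s \<in> {u + q..<u + q + N}. s mod N = t}"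
      unfolding r by auto
    moreover have "card \<dots> = card {s \<in> {u..<u + q}. s mod N = t} + 1"
      using card_residue_full_period[OF t, of "u + q"]
      by (subst card_Un_disjoint) auto
    ultimately have "card {s \<in> {u..<u + r}. s mod N = t} = card {s \<in> {u..<u + q}. s mod N = t} + 1"
      by simp
    then show ?thesis
      using less[OF \<open>q < r\<close>] t unfolding r by auto
  qed
qed

lemma div_cases_floor_ceiling:
  fixes m r N :: nat
  assumes "N > 0" and "m = r div N \<or> (m = r div N + 1 \<and> r mod N > 0)"
  shows "int m = \<lfloor>real r / real N\<rfloor> \<or> int m = \<lceil>real r / real N\<rceil>"
proof -
  have fl: "\<lfloor>real r / real N\<rfloor> = int (r div N)"
    by (simp add: floor_divide_of_nat_eq)
  have "\<lceil>real r / real N\<rceil> = int (r div N) + 1" if "r mod N > 0"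
  proof -
    have "real (r div N) < real r / real N"
    proof -
      have "(r div N) * N < r" using that
        by (metis div_mult_mod_eq less_add_same_cancel1)
      then show ?thesis using assms(1)
        by (simp add: pos_less_divide_eq flip: of_nat_mult)
    qed
    moreover have "real r / real N \<le> real (r div N) + 1"
      using floor_correct[of "real r / real N"] fl by simp
    ultimately show ?thesis by (intro ceiling_unique) auto
  qed
  then show ?thesis using assms(2) fl by auto
qed

text \<open>
  Position \<open>s\<close> of the row goes to class \<open>s mod N\<close>, so class \<open>t\<close> receives the positions
  \<open>t, N + t, \<dots>, (l - 1) N + t\<close>, and the copies of one symbol it receives are the numbers congruent to
  \<open>t\<close> in an interval of length \<open>r j\<close>.
\<close>

lemma dealing_symbols:
  fixes r :: "nat \<Rightarrow> nat"
  assumes N: "N > 0" and tot: "(\<Sum>j\<in>{1..k}. r j) = l * N"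
  shows "\<exists>M :: nat \<Rightarrow> nat multiset.
    (\<forall>t<N. size (M t) = l \<and> set_mset (M t) \<subseteq> {1..k}) \<and>
    (\<forall>j\<in>{1..k}. (\<Sum>t<N. count (M t) j) = r j \<and>
      (\<forall>t<N. int (count (M t) j) = \<lfloor>real (r j) / real N\<rfloor> \<or>
              int (count (M t) j) = \<lceil>real (r j) / real N\<rceil>))"
proof -
  obtain f u where f: "\<And>s. s < l * N \<Longrightarrow> f s \<in> {1..k}"
    and u: "\<And>j. j \<in> {1..k} \<Longrightarrow> {s. s < l * N \<and> f s = j} = {u j..<u j + r j}"
    using arrange_in_runs[where r = r and k = k] unfolding tot by blast
  define S where "S t = {s. s < l * N \<and> s mod N = t}" for t
  define M where "M t = image_mset f (mset_set (S t))" for t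
  have fin: "finite (S t)" for t by (simp add: S_def)
  have S: "S t = (\<lambda>q. q * N + t) ` {..<l}" if "t < N" for t
  proof (intro equalityI subsetI)
    fix s assume "s \<in> S t"
    then have "s = s div N * N + t" "s div N < l"
      by (auto simp: S_def less_mult_imp_div_less)
    then show "s \<in> (\<lambda>q. q * N + t) ` {..<l}" by blast
  next
    fix s assume "s \<in> (\<lambda>q. q * N + t) ` {..<l}"
    then obtain q where q: "q < l" "s = q * N + t" by auto
    have "q * N + t < (q + 1) * N" using that by simp
    also have "\<dots> \<le> l * N" using q by (intro mult_right_mono) auto
    finally show "s \<in> S t" using q that by (auto simp: S_def)
  qed
  have "card (S t) = l" if "t < N" for t
    unfolding S[OF that] using N by (subst card_image) (auto simp: inj_on_def)
  then have size: "size (M t) = l" if "t < N" for t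
    using that by (simp add: M_def)
  have sub: "set_mset (M t) \<subseteq> {1..k}" for t
    using f fin by (auto simp: M_def S_def)
  have cnt: "count (M t) j = card {s \<in> {u j..<u j + r j}. s mod N = t}" if "j \<in> {1..k}" for t j
  proof -
    have "count (M t) j = card {s \<in> S t. f s = j}"
    proof -
      have "count (M t) j = (\<Sum>s\<in>f -` {j} \<inter> S t. count (mset_set (S t)) s)"
        using fin by (simp add: M_def count_image_mset)
      also have "\<dots> = (\<Sum>s\<in>f -` {j} \<inter> S t. 1)"
        using fin by (intro sum.cong) auto
      also have "f -` {j} \<inter> S t = {s \<in> S t. f s = j}" by auto
      finally show ?thesis by simp
    qed
    also have "{s \<in> S t. f s = j} = {s \<in> {s. s < l * N \<and> f s = j}. s mod N = t}"
      by (auto simp: S_def)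
    finally show ?thesis unfolding u[OF that] .
  qed
  have sum: "(\<Sum>t<N. count (M t) j) = r j" if "j \<in> {1..k}" for j
  proof -
    have "(\<Sum>t<N. card {s \<in> {u j..<u j + r j}. s mod N = t})
        = card (\<Union>t<N. {s \<in> {u j..<u j + r j}. s mod N = t})"
      by (subst card_UN_disjoint) auto
    also have "(\<Union>t<N. {s \<in> {u j..<u j + r j}. s mod N = t}) = {u j..<u j + r j}"
      using N by auto
    finally show ?thesis using cnt[OF that] by simp
  qed
  show ?thesis
    using size sub sum cnt div_cases_floor_ceiling[OF N card_residue_run]
    by (intro exI[of _ M]) simp
qed

section \<open>Classes meeting every hyperplane and block once\<close>

abbreviation residue_tuples :: "nat set \<Rightarrow> (nat \<Rightarrow> nat) \<Rightarrow> (nat \<Rightarrow> int) set" where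
  "residue_tuples I a \<equiv> (\<Pi>\<^sub>E m\<in>I. {0..<int (a m)})"

text \<open>
  The tuples with a prescribed \<open>i\<close>th component are exactly as many as the elements of one group, so
  the groups can be matched with the values of that component and then coded one by one.
\<close>

lemma coding_by_residues:
  fixes a :: "nat \<Rightarrow> nat"
  assumes part: "partition_on X Q" and X: "finite X" and I: "finite I" "i \<in> I"
    and cardQ: "card Q = a i" and cardG: "\<And>G. G \<in> Q \<Longrightarrow> card G = (\<Prod>m\<in>I - {i}. a m)"
  shows "\<exists>e. inj_on e X \<and> e ` X \<subseteq> residue_tuples I a \<and>
    (\<forall>G\<in>Q. \<forall>v\<in>G. \<forall>w\<in>G. e v i = e w i)"
proof -
  have finQ: "finite Q" using finite_elements[OF X part] .
  obtain g where g: "bij_betw g Q {0..<int (a i)}"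
    using finite_same_card_bij[OF finQ, of "{0..<int (a i)}"] cardQ by auto
  let ?T = "\<lambda>G. \<Pi>\<^sub>E m\<in>I. if m = i then {g G} else {0..<int (a m)}"
  have "\<exists>h. bij_betw h G (?T G)" if G: "G \<in> Q" for G
  proof (rule finite_same_card_bij)
    have "G \<subseteq> X" using part G by (auto simp: partition_on_def)
    then show "finite G" using X finite_subset by blast
    show "finite (?T G)" using I by (intro finite_PiE) auto
    have "card (?T G) = (\<Prod>m\<in>I. if m = i then 1 else a m)"
      using I by (subst card_PiE) (auto intro!: prod.cong)
    also have "\<dots> = (\<Prod>m\<in>I - {i}. a m)"
      using I by (subst prod.remove[of I i]) (auto intro!: prod.cong)
    finally show "card G = card (?T G)" using cardG[OF G] by simp
  qed
  then obtain h where h: "\<And>G. G \<in> Q \<Longrightarrow> bij_betw (h G) G (?T G)" by metis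
  define grp where "grp v = (THE G. G \<in> Q \<and> v \<in> G)" for v
  have grp: "grp v = G" if "G \<in> Q" "v \<in> G" for G v
    unfolding grp_def using that part
    by (intro the_equality) (auto simp: partition_on_def disjoint_def)
  have ex: "\<exists>G\<in>Q. v \<in> G" if "v \<in> X" for v
    using that part by (auto simp: partition_on_def)
  define e where "e v = h (grp v) v" for v
  have mem: "e v \<in> ?T G" if "G \<in> Q" "v \<in> G" for G v
    unfolding e_def grp[OF that] using h[OF that(1)] that(2) by (rule bij_betw_apply)
  have at_i: "e v i = g G" if "G \<in> Q" "v \<in> G" for G v
    using PiE_mem[OF mem[OF that] I(2)] by simp
  have "inj_on e X"
  proof (rule inj_onI)
    fix v w assume "v \<in> X" "w \<in> X" and eq: "e v = e w"
    then obtain G G' where G: "G \<in> Q" "v \<in> G" and G': "G' \<in> Q" "w \<in> G'" using ex by meson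
    have "g G = g G'" using at_i[OF G] at_i[OF G'] eq by simp
    then have GG: "G = G'" using g G G' by (auto simp: bij_betw_def inj_on_def)
    then have "h G v = h G w" using eq grp[OF G] grp[OF G'] by (simp add: e_def)
    then show "v = w" using h[OF G(1)] G G' GG by (auto simp: bij_betw_def inj_on_def)
  qed
  moreover have "e ` X \<subseteq> residue_tuples I a"
  proof
    fix x assume "x \<in> e ` X"
    then obtain v where v: "v \<in> X" "x = e v" by auto
    then obtain G where G: "G \<in> Q" "v \<in> G" using ex by blast
    have "g G \<in> {0..<int (a i)}" using g G(1) by (rule bij_betw_apply)
    then have "?T G \<subseteq> residue_tuples I a" by (intro PiE_mono) auto
    then show "x \<in> residue_tuples I a" using mem[OF G] v(2) by blast
  qed
  ultimately show ?thesis using at_i by metis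
qed

text \<open>
  The coset of the diagonal subgroup that contains the cell \<open>c\<close>, given by the differences of the coded
  coordinates \<open>2, \<dots>, d\<close> to the first one; leaving out the first coordinate makes the number of possible
  values exactly \<open>n^(d-1)\<close>.
\<close>

definition difference_class ::
    "nat \<Rightarrow> (nat \<Rightarrow> nat) \<Rightarrow> (nat \<Rightarrow> nat \<Rightarrow> nat \<Rightarrow> int) \<Rightarrow> (nat \<Rightarrow> nat) \<Rightarrow> nat \<Rightarrow> nat \<Rightarrow> int" where
  "difference_class d a e c =
     (\<lambda>i\<in>{2..d}. \<lambda>m\<in>{1..d}. (e i (c i) m - e 1 (c 1) m) mod int (a m))"

lemma difference_class_mem:
  assumes "\<And>i. i \<in> {1..d} \<Longrightarrow> a i > 0"
  shows "difference_class d a e c \<in> (\<Pi>\<^sub>E i\<in>{2..d}. residue_tuples {1..d} a)"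
  unfolding difference_class_def using assms
  by (intro restrict_PiE_iff[THEN iffD2] ballI) auto

lemma residue_eqI:
  fixes x y m :: int
  assumes "x \<in> {0..<m}" "y \<in> {0..<m}" "(x - z) mod m = (y - z) mod m"
  shows "x = y"
proof -
  have "(x - z + z) mod m = (y - z + z) mod m" using assms(3) by (metis mod_add_left_eq)
  then show ?thesis using assms by simp
qed

text \<open>
  Two cells of a class differ by one translation \<open>s\<close> of all coordinates. Its \<open>m\<close>th component vanishes
  as soon as the \<open>m\<close>th components of the two cells agree in some coordinate; for a hyperplane that
  coordinate is the same for all \<open>m\<close>, for a block it is coordinate \<open>m\<close>.
\<close>

lemma difference_class_inj:
  assumes e: "\<And>i. i \<in> {1..d} \<Longrightarrow> inj_on (e i) {1..n} \<and> e i ` {1..n} \<subseteq> residue_tuples {1..d} a"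
    and c: "c \<in> cells n d" "c' \<in> cells n d"
    and same: "difference_class d a e c = difference_class d a e c'"
    and agree: "\<And>m. m \<in> {1..d} \<Longrightarrow> \<exists>i\<in>{1..d}. e i (c i) m = e i (c' i) m"
  shows "c = c'"
proof -
  have cell: "c i \<in> {1..n}" "c' i \<in> {1..n}" if "i \<in> {1..d}" for i
    using c that by (auto simp: cells_def)
  have tup: "e i (c i) \<in> residue_tuples {1..d} a" "e i (c' i) \<in> residue_tuples {1..d} a"
    if "i \<in> {1..d}" for i
    using e[OF that] cell[OF that] by blast+
  have comp: "e i (c i) m \<in> {0..<int (a m)}" "e i (c' i) m \<in> {0..<int (a m)}"
    if "i \<in> {1..d}" "m \<in> {1..d}" for i m
    using tup[OF that(1)] that(2) by (auto simp del: atLeastLessThan_iff)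
  have diff: "(e i (c i) m - e 1 (c 1) m) mod int (a m) = (e i (c' i) m - e 1 (c' 1) m) mod int (a m)"
    if "i \<in> {1..d}" "m \<in> {1..d}" for i m
  proof (cases "i = 1")
    case False
    then have "i \<in> {2..d}" using that by auto
    then show ?thesis
      using fun_cong[OF fun_cong[OF same, of i], of m] that by (simp add: difference_class_def)
  qed simp
  have one: "e 1 (c 1) m = e 1 (c' 1) m" if m: "m \<in> {1..d}" for m
  proof -
    obtain i where i: "i \<in> {1..d}" "e i (c i) m = e i (c' i) m" using agree[OF m] by blast
    have "1 \<in> {1..d}" using m by auto
    from diff[OF i(1) m] have "(- (e i (c i) m - e 1 (c 1) m)) mod int (a m)
        = (- (e i (c' i) m - e 1 (c' 1) m)) mod int (a m)"
      by (metis mod_minus_eq)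
    then show ?thesis
      using residue_eqI[OF comp(1)[OF \<open>1 \<in> {1..d}\<close> m] comp(2)[OF \<open>1 \<in> {1..d}\<close> m]] i(2) by simp
  qed
  have all: "e i (c i) m = e i (c' i) m" if "i \<in> {1..d}" "m \<in> {1..d}" for i m
    using diff[OF that] one[OF that(2)] by (intro residue_eqI[OF comp[OF that]]) simp
  have "c i = c' i" if i: "i \<in> {1..d}" for i
  proof -
    have "e i (c i) = e i (c' i)"
      using tup[OF i] all[OF i] by (intro PiE_ext) auto
    then show ?thesis using e[OF i] cell[OF i] by (meson inj_onD)
  qed
  then show ?thesis using c unfolding cells_def by (intro PiE_ext) auto
qed

lemma hyperplane_card:
  assumes "H \<in> hyperplanes n d"
  shows "card H = n ^ (d - 1)"
proof -
  obtain i v where i: "i \<in> {1..d}" and v: "v \<in> {1..n}" and H: "H = {c \<in> cells n d. c i = v}"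
    using assms by (auto simp: hyperplanes_def)
  have "H = (\<Pi>\<^sub>E m\<in>{1..d}. if m = i then {v} else {1..n})"
  proof (intro equalityI subsetI)
    fix c assume "c \<in> H"
    then show "c \<in> (\<Pi>\<^sub>E m\<in>{1..d}. if m = i then {v} else {1..n})"
      by (simp add: H cells_def PiE_iff)
  next
    fix c assume c: "c \<in> (\<Pi>\<^sub>E m\<in>{1..d}. if m = i then {v} else {1..n})"
    have "(\<Pi>\<^sub>E m\<in>{1..d}. if m = i then {v} else {1..n}) \<subseteq> cells n d"
      unfolding cells_def using v by (intro PiE_mono) auto
    moreover have "c i = v" using PiE_mem[OF c i] by simp
    ultimately show "c \<in> H" using c by (auto simp: H)
  qed
  then have "card H = (\<Prod>m\<in>{1..d}. if m = i then 1 else n)"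
    by (simp add: card_PiE if_distrib cong: if_cong)
  also have "\<dots> = (\<Prod>m\<in>{1..d} - {i}. n)"
    using i by (subst prod.remove[of _ i]) (auto intro!: prod.cong)
  finally show ?thesis using i by simp
qed

lemma block_card:
  assumes pos: "\<And>i. i \<in> {1..d} \<Longrightarrow> a i > 0" and d: "d > 0"
    and n: "n = (\<Prod>i\<in>{1..d}. a i)"
    and b: "\<And>i. i \<in> {1..d} \<Longrightarrow> b i = n div a i"
    and P: "coordinate_partitions n d a b P" and B: "B \<in> blocks d P"
  shows "card B = n ^ (d - 1)"
proof -
  obtain G where G: "\<And>i. i \<in> {1..d} \<Longrightarrow> G i \<in> P i" and BG: "B = (\<Pi>\<^sub>E i\<in>{1..d}. G i)"
    using B unfolding blocks_def by blast
  have "card B = (\<Prod>i\<in>{1..d}. b i)"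
    using P G by (auto simp: BG card_PiE coordinate_partitions_def intro!: prod.cong)
  moreover have "(\<Prod>i\<in>{1..d}. b i) * n = (\<Prod>i\<in>{1..d}. b i * a i)"
    unfolding prod.distrib by (simp add: n)
  moreover have "b i * a i = n" if "i \<in> {1..d}" for i
    using that by (simp add: b n dvd_prodI)
  ultimately have "card B * n = n ^ d" by simp
  also have "\<dots> = n ^ (d - 1) * n" using d by (metis power_minus_mult)
  finally have "card B * n = n ^ (d - 1) * n" .
  moreover have "n \<noteq> 0" using pos by (auto simp: n)
  ultimately show ?thesis by simp
qed

text \<open>
  The classes are numbered \<open>0, \<dots>, n^(d-1) - 1\<close>, the same index set by which \<open>dealing_symbols\<close> numbers
  its multisets.
\<close>

lemma transversal_classes:
  assumes d: "d > 0" and pos: "\<And>i. i \<in> {1..d} \<Longrightarrow> a i > 0"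
    and n: "n = (\<Prod>i\<in>{1..d}. a i)"
    and b: "\<And>i. i \<in> {1..d} \<Longrightarrow> b i = n div a i"
    and P: "coordinate_partitions n d a b P"
  shows "\<exists>q. (\<forall>c. q c < n ^ (d - 1)) \<and>
    (\<forall>H \<in> hyperplanes n d \<union> blocks d P. bij_betw q H {..<n ^ (d - 1)})"
proof -
  let ?Q = "\<Pi>\<^sub>E i\<in>{2..d}. residue_tuples {1..d} a"
  have part: "partition_on {1..n} (P i)" "card (P i) = a i" "\<And>G. G \<in> P i \<Longrightarrow> card G = b i"
    if "i \<in> {1..d}" for i
    using P that by (auto simp: coordinate_partitions_def)
  have bi: "b i = (\<Prod>m\<in>{1..d} - {i}. a m)" if "i \<in> {1..d}" for i
  proof -
    have "n = a i * (\<Prod>m\<in>{1..d} - {i}. a m)" unfolding n using that by (intro prod.remove) auto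
    then show ?thesis using b[OF that] pos[OF that] by simp
  qed
  have "\<exists>e. inj_on e {1..n} \<and> e ` {1..n} \<subseteq> residue_tuples {1..d} a \<and>
      (\<forall>G\<in>P i. \<forall>v\<in>G. \<forall>w\<in>G. e v i = e w i)" if "i \<in> {1..d}" for i
    using part[OF that] bi[OF that] that by (intro coding_by_residues) auto
  then obtain e where e: "\<And>i. i \<in> {1..d} \<Longrightarrow>
      inj_on (e i) {1..n} \<and> e i ` {1..n} \<subseteq> residue_tuples {1..d} a"
    and grp: "\<And>i G v w. i \<in> {1..d} \<Longrightarrow> G \<in> P i \<Longrightarrow> v \<in> G \<Longrightarrow> w \<in> G \<Longrightarrow> e i v i = e i w i"
    by metis
  have finQ: "finite ?Q" by (intro finite_PiE) auto
  have cardQ: "card ?Q = n ^ (d - 1)"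
    using d by (simp add: card_PiE n)
  obtain g where g: "bij_betw g ?Q {..<n ^ (d - 1)}"
    using finite_same_card_bij[OF finQ, of "{..<n ^ (d - 1)}"] cardQ by auto
  define q where "q c = g (difference_class d a e c)" for c
  have mem: "difference_class d a e c \<in> ?Q" for c
    using pos by (rule difference_class_mem)
  have qN: "q c < n ^ (d - 1)" for c
    using bij_betw_apply[OF g mem] by (simp add: q_def)
  \<comment> \<open>Injectivity is enough, since each of these sets has as many cells as there are classes.\<close>
  have bij: "bij_betw q H {..<n ^ (d - 1)}"
    if inj: "inj_on (difference_class d a e) H" and H: "card H = n ^ (d - 1)" for H
  proof -
    have "inj_on q H"
    proof (rule inj_onI)
      fix c c' assume c: "c \<in> H" "c' \<in> H" and "q c = q c'"
      then have "difference_class d a e c = difference_class d a e c'"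
        unfolding q_def using inj_onD[OF bij_betw_imp_inj_on[OF g]] mem by blast
      then show "c = c'" using inj_onD[OF inj] c by blast
    qed
    moreover have "q ` H = {..<n ^ (d - 1)}"
      using qN card_image[OF \<open>inj_on q H\<close>] H by (intro card_subset_eq) auto
    ultimately show ?thesis by (simp add: bij_betw_def)
  qed
  have "bij_betw q H {..<n ^ (d - 1)}" if H: "H \<in> hyperplanes n d" for H
  proof (rule bij)
    obtain i v where i: "i \<in> {1..d}" and Hi: "H = {c \<in> cells n d. c i = v}"
      using H by (auto simp: hyperplanes_def)
    show "inj_on (difference_class d a e) H"
    proof (rule inj_onI)
      fix c c' assume c: "c \<in> H" "c' \<in> H" and same: "difference_class d a e c = difference_class d a e c'"
      show "c = c'"
      proof (rule difference_class_inj[OF e _ _ same])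
        show "c \<in> cells n d" "c' \<in> cells n d" using c unfolding Hi by blast+
        have "c i = c' i" using c unfolding Hi by simp
        then show "\<exists>i\<in>{1..d}. e i (c i) m = e i (c' i) m" for m
          using i by (intro bexI[of _ i]) simp_all
      qed
    qed
  qed (rule hyperplane_card[OF H])
  moreover have "bij_betw q B {..<n ^ (d - 1)}" if B: "B \<in> blocks d P" for B
  proof (rule bij)
    obtain G where G: "\<And>i. i \<in> {1..d} \<Longrightarrow> G i \<in> P i" and BG: "B = (\<Pi>\<^sub>E i\<in>{1..d}. G i)"
      using B unfolding blocks_def by blast
    have "G i \<subseteq> {1..n}" if "i \<in> {1..d}" for i
      using part(1)[OF that] G[OF that] by (auto simp: partition_on_def)
    then have sub: "B \<subseteq> cells n d" unfolding BG cells_def by (intro PiE_mono) auto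
    show "inj_on (difference_class d a e) B"
    proof (rule inj_onI)
      fix c c' assume c: "c \<in> B" "c' \<in> B" and same: "difference_class d a e c = difference_class d a e c'"
      show "c = c'"
      proof (rule difference_class_inj[OF e _ _ same])
        show "c \<in> cells n d" "c' \<in> cells n d" using c sub by blast+
        show "\<exists>i\<in>{1..d}. e i (c i) m = e i (c' i) m" if m: "m \<in> {1..d}" for m
        proof (rule bexI[OF _ m])
          have "c m \<in> G m" "c' m \<in> G m" using c m unfolding BG by (auto elim: PiE_mem)
          then show "e m (c m) m = e m (c' m) m" by (rule grp[OF m G[OF m]])
        qed
      qed
    qed
  qed (rule block_card[OF pos d n b P B])
  ultimately show ?thesis using qN by (intro exI[of _ q]) auto
qed

section \<open>Balanced hypercubes\<close>

text \<open>
  Either all balanced hypercubes for the same data are simple or none is, because \<open>r\<^sub>j / n^(d-1)\<close> is the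
  average multiplicity of symbol \<open>j\<close> over a hyperplane and the balance condition lets no cell exceed this
  average rounded up.
\<close>

lemma balanced_hypercube_simple_iff:
  assumes bal: "balanced_hypercube l n d k r P L" and d: "d > 0" and n: "n > 0"
  shows "simple_hypercube n d L \<longleftrightarrow> (\<forall>j\<in>{1..k}. r j \<le> n ^ (d - 1))"
proof
  assume simple: "simple_hypercube n d L"
  define H where "H = {c \<in> cells n d. c 1 = 1}"
  have H: "H \<in> hyperplanes n d"
    unfolding hyperplanes_def H_def using d n by force
  show "\<forall>j\<in>{1..k}. r j \<le> n ^ (d - 1)"
  proof
    fix j assume "j \<in> {1..k}"
    then have "r j = (\<Sum>c\<in>H. count (L c) j)"
      using bal H by (auto simp: balanced_hypercube_def occurrences_def)
    also have "\<dots> \<le> (\<Sum>c\<in>H. 1)"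
      using simple by (intro sum_mono) (auto simp: simple_hypercube_def H_def)
    finally show "r j \<le> n ^ (d - 1)" using hyperplane_card[OF H] by simp
  qed
next
  assume r: "\<forall>j\<in>{1..k}. r j \<le> n ^ (d - 1)"
  show "simple_hypercube n d L"
    unfolding simple_hypercube_def
  proof (intro ballI allI)
    fix c j assume c: "c \<in> cells n d"
    show "count (L c) j \<le> 1"
    proof (cases "j \<in> {1..k}")
      case True
      have "real (r j) / real (n ^ (d - 1)) \<le> 1"
        using r True n by (simp add: divide_le_eq_1 flip: of_nat_power)
      then have "\<lceil>real (r j) / real (n ^ (d - 1))\<rceil> \<le> 1"
        "\<lfloor>real (r j) / real (n ^ (d - 1))\<rfloor> \<le> 1"
        by linarith+
      moreover have "int (count (L c) j) = \<lfloor>real (r j) / real (n ^ (d - 1))\<rfloor> \<or>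
          int (count (L c) j) = \<lceil>real (r j) / real (n ^ (d - 1))\<rceil>"
        using bal True c by (auto simp: balanced_hypercube_def)
      ultimately show ?thesis by linarith
    next
      case False
      then have "j \<notin># L c"
        using bal c unfolding balanced_hypercube_def fold_hypercube_def by blast
      then show ?thesis by (simp add: not_in_iff)
    qed
  qed
qed

theorem corollary2p2:
  fixes d l k n :: nat
    and a b r :: "nat \<Rightarrow> nat"
    and P :: "nat \<Rightarrow> nat set set"
  assumes "d > 0" and "l > 0" and "k > 0"
    and "\<And>i. i \<in> {1..d} \<Longrightarrow> a i > 0"
    and "n = (\<Prod>i\<in>{1..d}. a i)"
    and "\<And>i. i \<in> {1..d} \<Longrightarrow> b i = n div a i"
    and "coordinate_partitions n d a b P"
    and "\<And>j. j \<in> {1..k} \<Longrightarrow> r j > 0"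
    and "(\<Sum>j\<in>{1..k}. r j) = l * n ^ (d - 1)"
  shows "(\<exists>L. balanced_hypercube l n d k r P L) \<and>
    ((\<exists>L. balanced_hypercube l n d k r P L \<and> simple_hypercube n d L) \<longleftrightarrow>
      (\<forall>j\<in>{1..k}. r j \<le> n ^ (d - 1)))"
proof -
  let ?N = "n ^ (d - 1)"
  have n: "n > 0" using assms(4,5) by (simp add: prod_pos)
  then have N: "?N > 0" by simp
  obtain q where q: "\<And>c. q c < ?N"
    and bij: "\<And>H. H \<in> hyperplanes n d \<union> blocks d P \<Longrightarrow> bij_betw q H {..<?N}"
    using transversal_classes[OF assms(1,4,5,6,7)] by blast
  obtain M :: "nat \<Rightarrow> nat multiset"
    where M: "\<And>t. t < ?N \<Longrightarrow> size (M t) = l \<and> set_mset (M t) \<subseteq> {1..k}"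
    and tot: "\<And>j. j \<in> {1..k} \<Longrightarrow> (\<Sum>t<?N. count (M t) j) = r j"
    and even_spread: "\<And>j t. j \<in> {1..k} \<Longrightarrow> t < ?N \<Longrightarrow>
      int (count (M t) j) = \<lfloor>real (r j) / real ?N\<rfloor> \<or>
      int (count (M t) j) = \<lceil>real (r j) / real ?N\<rceil>"
    using dealing_symbols[OF N assms(9)] by blast
  define L where "L c = M (q c)" for c
  have occ: "occurrences L j H = r j" if "H \<in> hyperplanes n d \<union> blocks d P" "j \<in> {1..k}" for H j
    using sum.reindex_bij_betw[OF bij[OF that(1)], of "\<lambda>t. count (M t) j"] tot[OF that(2)]
    by (simp add: occurrences_def L_def)
  have bal: "balanced_hypercube l n d k r P L"
    unfolding balanced_hypercube_def fold_hypercube_def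
  proof (intro conjI ballI)
    fix c j assume "j \<in> {1..k}"
    then show "int (count (L c) j) = \<lfloor>real (r j) / real ?N\<rfloor> \<or>
        int (count (L c) j) = \<lceil>real (r j) / real ?N\<rceil>"
      unfolding L_def using q by (rule even_spread)
  qed (use M[OF q] occ in \<open>auto simp: L_def\<close>)
  then show ?thesis
    using balanced_hypercube_simple_iff[OF _ assms(1) n] by blast
qed

end
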